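(* For every even $g\ge 4$, ${\rm fasd}(3,g)\le g-\left\lfloor \frac g4-1\right\rfloor$. For every odd $g\ge 7$, ${\rm fasd}(3,g)\le g-\left\lfloor\frac{g-7}{4}\right\rfloor$. Moreover, ${\rm fasd}(3,g)<g$ for all $g\ge 8$.
   Context: An oriented graph is a digraph without loops, multiple arcs or directed $2$-cycles. Degree = in-degree + out-degree; directed girth = minimum length of a directed cycle ($\infty$ if none). For a digraph $D$, ${\rm fasd}(D)$ is the maximum number $t$ such that $A(D)$ can be partitioned into $t$ feedback arc sets (sets of arcs whose removal makes $D$ acyclic), with ${\rm fasd}(D)=\infty$ if $D$ is acyclic. ${\rm fasd}(\Delta,g)$ is the minimum of ${\rm fasd}(D)$ over all oriented graphs $D$ with maximum degree at most $\Delta$ and directed girth at least $g$. *)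

theory Defs
  imports
    Complex_Main
    "HOL-Library.Extended_Nat"
    "HOL-Library.Disjoint_Sets"
    "Graph_Theory.Digraph"
    "Graph_Theory.Arc_Walk"
    "Graph_Theory.Pair_Digraph"
begin

locale oriented_graph = digraph +
  assumes no_2_cycles: "u \<rightarrow> v \<Longrightarrow> \<not> v \<rightarrow> u"

definition max_degree_le :: "('a, 'b) pre_digraph \<Rightarrow> nat \<Rightarrow> bool" where
  "max_degree_le D \<Delta> \<longleftrightarrow> (\<forall>v \<in> verts D. in_degree D v + out_degree D v \<le> \<Delta>)"

text \<open>The infimum of the empty set in \<^typ>\<open>enat\<close> is \<^term>\<open>\<infinity>\<close>.\<close>

definition directed_girth :: "('a, 'b) pre_digraph \<Rightarrow> enat" where
  "directed_girth D = (INF p \<in> {p. pre_digraph.cycle D p}. enat (length p))"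

definition acyclic_digraph :: "('a, 'b) pre_digraph \<Rightarrow> bool" where
  "acyclic_digraph D \<longleftrightarrow> (\<nexists>p. pre_digraph.cycle D p)"

definition feedback_arc_set :: "('a, 'b) pre_digraph \<Rightarrow> 'b set \<Rightarrow> bool" where
  "feedback_arc_set D F \<longleftrightarrow> F \<subseteq> arcs D \<and> acyclic_digraph (D\<lparr>arcs := arcs D - F\<rparr>)"

definition fas_partition :: "('a, 'b) pre_digraph \<Rightarrow> 'b set set \<Rightarrow> bool" where
  "fas_partition D P \<longleftrightarrow> partition_on (arcs D) P \<and> (\<forall>F \<in> P. feedback_arc_set D F)"

definition fasd :: "('a, 'b) pre_digraph \<Rightarrow> enat" where
  "fasd D =
     (if acyclic_digraph D then \<infinity>
      else enat (GREATEST t. \<exists>P. fas_partition D P \<and> card P = t))"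

text \<open>
  In a finite digraph that is not acyclic the maximum exists, so that \<^const>\<open>Greatest\<close>
  picks out a genuine maximum.
\<close>

lemma (in fin_digraph) fasd_maximum:
  assumes "\<not> acyclic_digraph G"
  obtains P where "fas_partition G P" "fasd G = enat (card P)"
    and "\<And>Q. fas_partition G Q \<Longrightarrow> card Q \<le> card P"
proof -
  let ?R = "\<lambda>t. \<exists>P. fas_partition G P \<and> card P = t"
  have bound: "t \<le> card (Pow (arcs G))" if "?R t" for t
    using that by (auto simp: fas_partition_def partition_on_def intro!: card_mono)
  have "arcs G \<noteq> {}"
    using assms by (auto simp: acyclic_digraph_def cycle_def awalk_def)
  moreover have "acyclic_digraph (G\<lparr>arcs := {}\<rparr>)"
    by (auto simp: acyclic_digraph_def pre_digraph.cycle_def pre_digraph.awalk_def)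
  ultimately have "fas_partition G {arcs G}"
    by (auto simp: fas_partition_def feedback_arc_set_def partition_on_def)
  then have "?R 1"
    by (intro exI[of _ "{arcs G}"]) simp
  then have "?R (Greatest ?R)"
    using bound by (rule GreatestI_nat)
  moreover have "card Q \<le> Greatest ?R" if "fas_partition G Q" for Q
    using that bound by (intro Greatest_le_nat[of ?R]) auto
  ultimately show ?thesis
    using assms that unfolding fasd_def by (metis (no_types, lifting))
qed

text \<open>
  Digraphs are finite, and every finite oriented graph is isomorphic to one whose vertices
  are natural numbers and whose arcs are pairs of vertices. The infimum is a minimum:
  \<^typ>\<open>enat\<close> is well-ordered, and the empty graph shows that the set is nonempty.
\<close>

definition fasd_min :: "nat \<Rightarrow> nat \<Rightarrow> enat" where
  "fasd_min \<Delta> g =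
     Inf {fasd (with_proj D) | D :: nat pair_pre_digraph.
            oriented_graph (with_proj D) \<and> max_degree_le (with_proj D) \<Delta> \<and>
            enat g \<le> directed_girth (with_proj D)}"

end

theory Submission
  imports Defs
begin

text \<open>
  In the complete digraph on three vertices no single vertex meets all directed cycles. Split
  each vertex into a source, receiving its in-arcs, and a sink, sending its out-arcs, joined by a
  directed path. The resulting oriented graph has maximum degree 3, and deleting one arc leaves a
  cycle, so every feedback arc set has at least two arcs and \<open>fasd\<close> is at most half the number of
  arcs. Every cycle traverses at least two of the three paths completely, so paths of about
  \<open>g / 2\<close> arcs give girth \<open>g\<close> with only about \<open>3 g / 2\<close> arcs altogether.
\<close>

section \<open>Cycles, feedback arc sets and a counting bound in general digraphs\<close>

text \<open>A cycle is a closed walk, so its last arc is followed by \<open>hd p\<close>. This lets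
  the girth argument follow a cycle through its set of arcs, without positions in the list.\<close>

lemma (in wf_digraph) cycle_next_arc:
  assumes "cycle p" "e \<in> set p"
  obtains e' where "e' \<in> set p" "tail G e' = head G e"
proof -
  obtain u where u: "awalk u p u" "p \<noteq> []"
    using assms(1) by (auto simp: cycle_def)
  obtain xs ys where p: "p = xs @ e # ys"
    using assms(2) by (auto dest: split_list)
  with u have ys: "awalk (head G e) ys u"
    by (auto simp: awalk_Cons_iff)
  show ?thesis
  proof (cases ys)
    case Nil
    with ys have "head G e = u" by (simp add: awalk_Nil_iff)
    moreover have "tail G (hd p) = u"
      using u by (cases p) (auto simp: awalk_Cons_iff)
    ultimately show ?thesis using that[of "hd p"] u by simp
  next
    case (Cons e' zs)
    with ys p show ?thesis using that[of e'] by (auto simp: awalk_Cons_iff)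
  qed
qed

text \<open>A nonempty closed walk contains a cycle, so exhibiting a surviving closed walk is enough
  and its vertices need not be shown distinct.\<close>

lemma (in wf_digraph) trancl_imp_not_feedback_arc_set:
  assumes "(u, u) \<in> (arcs_ends (G\<lparr>arcs := arcs G - F\<rparr>))\<^sup>+"
  shows "\<not> feedback_arc_set G F"
proof -
  interpret H: wf_digraph "G\<lparr>arcs := arcs G - F\<rparr>"
    by unfold_locales auto
  obtain p where "H.awalk u p u" "p \<noteq> []"
    using assms H.reachable1_awalk by blast
  then have "H.closed_w p" by (auto simp: H.closed_w_def)
  then show ?thesis
    using H.closed_w_imp_cycle by (auto simp: feedback_arc_set_def acyclic_digraph_def)
qed

text \<open>The parts of an optimal partition are disjoint and each uses up at least
  \<open>d\<close> arcs.\<close>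

lemma (in fin_digraph) fasd_le_arcs_div:
  assumes "\<not> acyclic_digraph G" "0 < d"
    and d: "\<And>F. feedback_arc_set G F \<Longrightarrow> d \<le> card F"
  shows "fasd G \<le> enat (card (arcs G) div d)"
proof -
  obtain P where P: "fas_partition G P" "fasd G = enat (card P)"
    using fasd_maximum[OF assms(1)] by blast
  then have part: "partition_on (arcs G) P" and "\<forall>F\<in>P. d \<le> card F"
    using d by (auto simp: fas_partition_def)
  then have "card P * d \<le> (\<Sum>F\<in>P. card F)"
    using sum_bounded_below[of P d card] by simp
  also have "\<dots> = card (\<Union>P)"
  proof (rule card_Union_disjoint[symmetric])
    show "pairwise disjnt P"
      using part by (simp add: partition_on_def disjoint_def pairwise_def disjnt_def)
    show "finite F" if "F \<in> P" for F
      using that part by (auto simp: partition_on_def intro: finite_subset)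
  qed
  also have "\<dots> = card (arcs G)"
    using part by (simp add: partition_on_def)
  finally show ?thesis
    using P(2) \<open>0 < d\<close> by (simp add: less_eq_div_iff_mult_less_eq)
qed

section \<open>The split complete digraph and its number of arcs\<close>

text \<open>
  Vertex \<open>3 * d + i\<close> with \<open>i < 3\<close> is the vertex at distance \<open>d\<close> from the source \<open>i\<close> of the
  \<open>i\<close>-th path.
\<close>

definition path_end :: "(nat \<Rightarrow> nat) \<Rightarrow> nat \<Rightarrow> nat" where
  "path_end len i = 3 * len i + i"

text \<open>The residue mod 3 of a vertex names its path. The sources 0, 1, 2 coincide with the path
  indices, so \<open>(path_end len i, j)\<close> is the link from the sink of path \<open>i\<close>
  to the source of path \<open>j\<close>.\<close>

definition split_K3 :: "(nat \<Rightarrow> nat) \<Rightarrow> nat pair_pre_digraph" where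
  "split_K3 len =
     \<lparr>pverts = {v. v \<le> path_end len (v mod 3)},
      parcs = {(v, v + 3) | v. v < path_end len (v mod 3)} \<union>
              {(path_end len i, j) | i j. i < 3 \<and> j < 3 \<and> i \<noteq> j}\<rparr>"

lemma path_end_mod [simp]: "i < 3 \<Longrightarrow> path_end len i mod 3 = i"
  by (simp add: path_end_def)

lemma split_K3_arc_cases:
  assumes "e \<in> parcs (split_K3 len)"
  obtains (path) v where "e = (v, v + 3)" "v < path_end len (v mod 3)"
    | (link) i j where "e = (path_end len i, j)" "i < 3" "j < 3" "i \<noteq> j"
  using assms by (auto simp: split_K3_def)

lemma split_K3_path_arc: "v < path_end len (v mod 3) \<Longrightarrow> (v, v + 3) \<in> parcs (split_K3 len)"
  by (auto simp: split_K3_def)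

lemma split_K3_link_arc:
  "i < 3 \<Longrightarrow> j < 3 \<Longrightarrow> i \<noteq> j \<Longrightarrow> (path_end len i, j) \<in> parcs (split_K3 len)"
  by (auto simp: split_K3_def)

text \<open>Both sides are congruent mod 3, so a strict gap is at least 3.\<close>

lemma less_path_end_imp: "v < path_end len (v mod 3) \<Longrightarrow> v + 3 \<le> path_end len (v mod 3)"
  unfolding path_end_def by presburger

text \<open>One image per path and one for the six links: the finite index sets give finiteness as
  well as the bound on the number of arcs.\<close>

lemma split_K3_parcs_subset:
  "parcs (split_K3 len) \<subseteq>
     (\<lambda>d. (3 * d, 3 * d + 3)) ` {..<len 0} \<union>
     (\<lambda>d. (3 * d + 1, 3 * d + 4)) ` {..<len 1} \<union>
     (\<lambda>d. (3 * d + 2, 3 * d + 5)) ` {..<len 2} \<union>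
     (\<lambda>(i, j). (path_end len i, j)) ` {(0,1), (0,2), (1,0), (1,2), (2,0), (2,1)}"
proof
  fix e assume "e \<in> parcs (split_K3 len)"
  then show "e \<in> (\<lambda>d. (3 * d, 3 * d + 3)) ` {..<len 0} \<union>
     (\<lambda>d. (3 * d + 1, 3 * d + 4)) ` {..<len 1} \<union>
     (\<lambda>d. (3 * d + 2, 3 * d + 5)) ` {..<len 2} \<union>
     (\<lambda>(i, j). (path_end len i, j)) ` {(0,1), (0,2), (1,0), (1,2), (2,0), (2,1)}"
  proof (cases rule: split_K3_arc_cases)
    case (path v)
    have v: "v = 3 * (v div 3) + v mod 3" by simp
    have less: "v div 3 < len (v mod 3)"
      using path(2) unfolding path_end_def by presburger
    consider "v mod 3 = 0" | "v mod 3 = 1" | "v mod 3 = 2" by linarith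
    then show ?thesis
    proof cases
      case 1 then show ?thesis using v less path(1) by (auto intro!: image_eqI[of _ _ "v div 3"])
    next
      case 2 then show ?thesis using v less path(1) by (auto intro!: image_eqI[of _ _ "v div 3"])
    next
      case 3 then show ?thesis using v less path(1) by (auto intro!: image_eqI[of _ _ "v div 3"])
    qed
  next
    case (link i j)
    then have "(i, j) \<in> {(0,1), (0,2), (1,0), (1,2), (2,0), (2,1)}"
      by (auto simp: less_Suc_eq numeral_3_eq_3)
    then show ?thesis using link(1) by (intro UnI2 image_eqI[of _ _ "(i, j)"]) simp_all
  qed
qed

lemma finite_parcs_split_K3: "finite (parcs (split_K3 len))"
  by (rule finite_subset[OF split_K3_parcs_subset]) simp

lemma card_parcs_split_K3_le: "card (parcs (split_K3 len)) \<le> len 0 + len 1 + len 2 + 6"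
proof -
  let ?I = "{(0,1), (0,2), (1,0), (1,2), (2,0), (2,1)} :: (nat \<times> nat) set"
  let ?A = "(\<lambda>d. (3 * d, 3 * d + 3)) ` {..<len 0}"
  let ?B = "(\<lambda>d. (3 * d + 1, 3 * d + 4)) ` {..<len 1}"
  let ?C = "(\<lambda>d. (3 * d + 2, 3 * d + 5)) ` {..<len 2}"
  let ?L = "(\<lambda>(i, j). (path_end len i, j)) ` ?I"
  have "card (parcs (split_K3 len)) \<le> card (?A \<union> ?B \<union> ?C \<union> ?L)"
    by (intro card_mono split_K3_parcs_subset) simp
  also have "\<dots> \<le> card ?A + card ?B + card ?C + card ?L"
    by (meson add_mono card_Un_le le_refl le_trans)
  also have "\<dots> \<le> card {..<len 0} + card {..<len 1} + card {..<len 2} + card ?I"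
    by (intro add_mono card_image_le) simp_all
  also have "\<dots> = len 0 + len 1 + len 2 + 6" by simp
  finally show ?thesis .
qed

section \<open>Well-formedness, orientation and maximum degree\<close>

lemma pair_wf_digraph_split_K3: "pair_wf_digraph (split_K3 len)"
proof
  fix e assume e: "e \<in> parcs (split_K3 len)"
  then show "fst e \<in> pverts (split_K3 len)"
    by (cases rule: split_K3_arc_cases) (auto simp: split_K3_def)
  from e show "snd e \<in> pverts (split_K3 len)"
  proof (cases rule: split_K3_arc_cases)
    case (path v)
    then show ?thesis using less_path_end_imp[of v len] by (simp add: split_K3_def)
  qed (simp add: split_K3_def path_end_def)
qed

lemma finite_pverts_split_K3: "finite (pverts (split_K3 len))"
proof (rule finite_subset)
  show "pverts (split_K3 len) \<subseteq> (\<Union>i<3. {..path_end len i})"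
    by (auto simp: split_K3_def intro!: bexI[of _ "_ mod 3"])
qed simp

lemma oriented_graph_split_K3:
  assumes pos: "\<And>i. i < 3 \<Longrightarrow> 0 < len i"
  shows "oriented_graph (with_proj (split_K3 len))"
proof -
  interpret pair_wf_digraph "split_K3 len" by (rule pair_wf_digraph_split_K3)
  have end_ge: "3 \<le> path_end len i" if "i < 3" for i
    using pos[OF that] by (simp add: path_end_def)
  \<comment> \<open>A path arc climbs by 3; a link drops from at least 3 to below 3 and changes the
    residue. No two such moves are inverse to each other, and a loop would be its own
    inverse.\<close>
  have shape: "v = u + 3 \<or> v < 3 \<and> 3 \<le> u \<and> u mod 3 \<noteq> v"
    if "(u, v) \<in> parcs (split_K3 len)" for u v
    using that by (cases rule: split_K3_arc_cases) (auto dest: end_ge)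
  have asym: False
    if uv: "(u, v) \<in> parcs (split_K3 len)" and vu: "(v, u) \<in> parcs (split_K3 len)" for u v
    using shape[OF uv] shape[OF vu] by auto
  show ?thesis
  proof unfold_locales
    fix e assume "e \<in> arcs (with_proj (split_K3 len))"
    then show "tail (with_proj (split_K3 len)) e \<noteq> head (with_proj (split_K3 len)) e"
      using asym[of "fst e" "fst e"] by (cases e) auto
  qed (use asym in \<open>auto simp: finite_pverts_split_K3 finite_parcs_split_K3 arc_to_ends_def\<close>)
qed

text \<open>As the paths have positive length, no vertex is both source and sink. A source has at
  most 2 arcs in and 1 out, a sink 1 in and 2 out, an inner vertex 1 in and 1 out.\<close>

lemma max_degree_split_K3:
  assumes pos: "\<And>i. i < 3 \<Longrightarrow> 0 < len i"
  shows "max_degree_le (with_proj (split_K3 len)) 3"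
  unfolding max_degree_le_def
proof
  let ?D = "with_proj (split_K3 len)"
  fix v assume "v \<in> verts ?D"
  then have v: "v \<le> path_end len (v mod 3)" by (simp add: split_K3_def)
  have end_ge: "3 \<le> path_end len i" if "i < 3" for i
    using pos[OF that] by (simp add: path_end_def)
  have others: "card ({0,1,2} - {i}) = 2" if "i < 3" for i :: nat
    using that by (auto simp: less_Suc_eq numeral_3_eq_3)
  have out_path: "out_degree ?D v \<le> 1" if "v < path_end len (v mod 3)"
  proof -
    have "out_arcs ?D v \<subseteq> {(v, v + 3)}"
      using that by (auto simp: out_arcs_def elim!: split_K3_arc_cases)
    from card_mono[OF _ this] show ?thesis by (simp add: out_degree_def)
  qed
  have out_end: "out_degree ?D v \<le> 2" if "v = path_end len (v mod 3)"
  proof -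
    have "out_arcs ?D v \<subseteq> Pair v ` ({0,1,2} - {v mod 3})"
    proof
      fix e assume "e \<in> out_arcs ?D v"
      then have e: "e \<in> parcs (split_K3 len)" "fst e = v" by (auto simp: out_arcs_def)
      from e(1) show "e \<in> Pair v ` ({0,1,2} - {v mod 3})"
        by (cases rule: split_K3_arc_cases) (use e(2) that in auto)
    qed
    from card_mono[OF _ this] have "out_degree ?D v \<le> card (Pair v ` ({0,1,2} - {v mod 3}))"
      by (simp add: out_degree_def)
    also have "\<dots> \<le> 2"
      using card_image_le[of "{0,1,2} - {v mod 3}" "Pair v"] others[of "v mod 3"] by simp
    finally show ?thesis .
  qed
  have in_path: "in_degree ?D v \<le> 1" if "3 \<le> v"
  proof -
    have "in_arcs ?D v \<subseteq> {(v - 3, v)}"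
      using that by (auto simp: in_arcs_def elim!: split_K3_arc_cases)
    from card_mono[OF _ this] show ?thesis by (simp add: in_degree_def)
  qed
  have in_source: "in_degree ?D v \<le> 2" if "v < 3"
  proof -
    have "in_arcs ?D v \<subseteq> (\<lambda>i. (path_end len i, v)) ` ({0,1,2} - {v})"
    proof
      fix e assume "e \<in> in_arcs ?D v"
      then have e: "e \<in> parcs (split_K3 len)" "snd e = v" by (auto simp: in_arcs_def)
      from e(1) show "e \<in> (\<lambda>i. (path_end len i, v)) ` ({0,1,2} - {v})"
        by (cases rule: split_K3_arc_cases) (use e(2) that in auto)
    qed
    from card_mono[OF _ this]
    have "in_degree ?D v \<le> card ((\<lambda>i. (path_end len i, v)) ` ({0,1,2} - {v}))"
      by (simp add: in_degree_def)
    also have "\<dots> \<le> 2"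
      using card_image_le[of "{0,1,2} - {v}" "\<lambda>i. (path_end len i, v)"] others[OF that] by simp
    finally show ?thesis .
  qed
  show "in_degree ?D v + out_degree ?D v \<le> 3"
  proof (cases "v = path_end len (v mod 3)")
    case True
    then have "3 \<le> v" using end_ge[of "v mod 3"] by simp
    then show ?thesis using in_path out_end[OF True] by simp
  next
    case False
    then have "out_degree ?D v \<le> 1" using v out_path by simp
    then show ?thesis using in_path in_source by (cases "v < 3") auto
  qed
qed

section \<open>Directed girth\<close>

text \<open>A cycle can leave a path only at its sink, and then enters a different path at its
  source. Hence it contains two whole paths, with \<open>len i + 1\<close> and
  \<open>len j + 1\<close> vertices.\<close>

lemma directed_girth_split_K3:
  assumes len: "\<And>i j. i < 3 \<Longrightarrow> j < 3 \<Longrightarrow> i \<noteq> j \<Longrightarrow> g \<le> len i + len j + 2"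
  shows "enat g \<le> directed_girth (with_proj (split_K3 len))"
  unfolding directed_girth_def
proof (rule INF_greatest)
  let ?D = "with_proj (split_K3 len)"
  interpret pair_wf_digraph "split_K3 len" by (rule pair_wf_digraph_split_K3)
  fix p assume "p \<in> {p. pre_digraph.cycle ?D p}"
  then have p: "pre_digraph.cycle ?D p" by simp
  \<comment> \<open>The vertices of the cycle; the length of \<open>p\<close> is at least their
    number.\<close>
  define T where "T = fst ` set p"
  have sub: "set p \<subseteq> parcs (split_K3 len)" and "p \<noteq> []"
    using p by (auto simp: cycle_def awalk_def)
  have succ: "w \<in> T" if vw: "(v, w) \<in> set p" for v w
  proof -
    obtain e where "e \<in> set p" "fst e = w" using cycle_next_arc[OF p vw] by auto
    then show ?thesis by (auto simp: T_def)
  qed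
  have path: "v + 3 \<in> T" if "v \<in> T" and less: "v < path_end len (v mod 3)" for v
  proof -
    obtain w where w: "(v, w) \<in> set p" using \<open>v \<in> T\<close> by (auto simp: T_def)
    with sub have "(v, w) \<in> parcs (split_K3 len)" by auto
    then have "w = v + 3"
      by (cases rule: split_K3_arc_cases) (use less in auto)
    then show ?thesis using succ w by blast
  qed
  have link: "\<exists>j<3. j \<noteq> i \<and> j \<in> T" if iT: "path_end len i \<in> T" and "i < 3" for i
  proof -
    obtain w where w: "(path_end len i, w) \<in> set p" using iT by (force simp: T_def)
    with sub have "(path_end len i, w) \<in> parcs (split_K3 len)" by (rule subsetD)
    then have "w < 3 \<and> w \<noteq> i"
    proof (cases rule: split_K3_arc_cases)
      case (link i' j)
      then have "i' = i" using path_end_mod \<open>i < 3\<close> by (metis prod.inject)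
      with link show ?thesis by simp
    qed (use \<open>i < 3\<close> in auto)
    then show ?thesis using succ w by blast
  qed
  have along: "v + 3 * d \<in> T" if "v \<in> T" "v + 3 * d \<le> path_end len (v mod 3)" for v d
    using that(2)
  proof (induction d)
    case (Suc d)
    then show ?case using path[of "v + 3 * d"] by (simp add: add.commute add.left_commute)
  qed (use that in simp)
  have whole: "(\<lambda>d. 3 * d + i) ` {..len i} \<subseteq> T" if "i \<in> T" "i < 3" for i
    using along[of i] that by (auto simp: path_end_def add.commute)
  have to_end: "path_end len (v mod 3) \<in> T" if "v \<in> T" for v
  proof -
    obtain w where "(v, w) \<in> set p" using \<open>v \<in> T\<close> by (auto simp: T_def)
    then have "v \<in> pverts (split_K3 len)"
      using sub arc_fst_in_verts by fastforce
    then have "v \<le> path_end len (v mod 3)" by (simp add: split_K3_def)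
    \<comment> \<open>\<open>v div 3\<close> is the distance of \<open>v\<close> from the source of
      its path, so the difference is the distance left to the sink.\<close>
    then have "v + 3 * (len (v mod 3) - v div 3) = path_end len (v mod 3)"
      unfolding path_end_def by presburger
    then show ?thesis using along[OF that, of "len (v mod 3) - v div 3"] by simp
  qed
  obtain v where "v \<in> T" using \<open>p \<noteq> []\<close> by (cases p) (auto simp: T_def)
  \<comment> \<open>The vertex \<open>v\<close> may lie inside a path, so the argument restarts at
    the source \<open>i\<close> entered after the next sink; running through path \<open>i\<close>
    then leads to a second source \<open>j\<close>.\<close>
  then obtain i where i: "i < 3" "i \<in> T" using link[OF to_end] by auto
  then obtain j where j: "j < 3" "j \<noteq> i" "j \<in> T" using link[of i] to_end[of i] by auto
  let ?I = "(\<lambda>d. 3 * d + i) ` {..len i}" and ?J = "(\<lambda>d. 3 * d + j) ` {..len j}"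
  have "3 * d + i \<noteq> 3 * d' + j" for d d' using i j by presburger
  then have "?I \<inter> ?J = {}" by auto
  then have "card (?I \<union> ?J) = len i + len j + 2"
    by (simp add: card_Un_disjoint card_image inj_on_def)
  then have "g \<le> card (?I \<union> ?J)" using len[of i j] i j by simp
  also have "\<dots> \<le> card T"
    using whole i j by (intro card_mono) (auto simp: T_def)
  also have "\<dots> \<le> length p"
    unfolding T_def by (meson List.finite_set card_image_le card_length le_trans)
  finally show "enat g \<le> enat (length p)" by simp
qed

section \<open>Feedback arc sets have at least two arcs\<close>

text \<open>Any two paths and the two links between them form a closed walk, and no arc lies on all
  three of these walks. Letting \<open>e\<close> be arbitrary also covers the case where nothing is
  deleted.\<close>

lemma split_K3_trancl_avoiding_arc: "\<exists>u. (u, u) \<in> (parcs (split_K3 len) - {e})\<^sup>+"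
proof -
  let ?R = "parcs (split_K3 len) - {e}"
  have through: "(i, path_end len i) \<in> ?R\<^sup>*"
    if "i < 3" and e: "\<And>v. v < path_end len i \<Longrightarrow> v mod 3 = i \<Longrightarrow> e \<noteq> (v, v + 3)" for i
  proof -
    have "d \<le> len i \<Longrightarrow> (i, 3 * d + i) \<in> ?R\<^sup>*" for d
    proof (induction d)
      case (Suc d)
      have less: "3 * d + i < path_end len i" using Suc.prems by (simp add: path_end_def)
      have "(3 * d + i, 3 * d + i + 3) \<in> ?R"
        using split_K3_path_arc[of "3 * d + i" len] e[OF less] less \<open>i < 3\<close> by auto
      moreover have "(i, 3 * d + i) \<in> ?R\<^sup>*" using Suc by simp
      ultimately have "(i, 3 * d + i + 3) \<in> ?R\<^sup>*" by (rule rtrancl_into_rtrancl[rotated])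
      then show ?case by (simp add: add.commute add.left_commute)
    qed simp
    then show ?thesis by (simp add: path_end_def)
  qed
  have cycle: "(i, i) \<in> ?R\<^sup>+"
    if "i < 3" "j < 3" "i \<noteq> j" "e \<noteq> (path_end len i, j)" "e \<noteq> (path_end len j, i)"
      and "\<And>v. v < path_end len (v mod 3) \<Longrightarrow> v mod 3 \<in> {i, j} \<Longrightarrow> e \<noteq> (v, v + 3)" for i j
  proof -
    have "(i, path_end len i) \<in> ?R\<^sup>*" "(j, path_end len j) \<in> ?R\<^sup>*"
      using that by (auto intro!: through)
    moreover have "(path_end len i, j) \<in> ?R" "(path_end len j, i) \<in> ?R"
      using that split_K3_link_arc by auto
    ultimately show ?thesis
      by (meson rtrancl_into_trancl1 trancl_trans)
  qed
  have third: "\<exists>k<3. k \<noteq> a \<and> k \<noteq> b" for a b :: nat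
  proof -
    have "\<not> {0, 1, 2} \<subseteq> {a, b}"
      using card_mono[of "{a, b}" "{0, 1, 2}"] card_insert_le_m1[of 2 "{b}" a] by auto
    then obtain k where "k \<in> {0, 1, 2}" "k \<notin> {a, b}" by blast
    then show ?thesis by (intro exI[of _ k]) auto
  qed
  show ?thesis
  proof (cases "e \<in> parcs (split_K3 len)")
    case True
    then show ?thesis
    proof (cases rule: split_K3_arc_cases)
      case (path v)
      \<comment> \<open>A deleted path arc spares the other two paths and all links.\<close>
      obtain i where i: "i < 3" "i \<noteq> v mod 3" using third by blast
      obtain j where j: "j < 3" "j \<noteq> v mod 3" "j \<noteq> i" using third by blast
      have "e \<noteq> (path_end len k, l)" if "k < 3" "k \<noteq> v mod 3" for k l
        using path that by auto
      then have "(i, i) \<in> ?R\<^sup>+" using i j path by (intro cycle[of i j]) auto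
      then show ?thesis ..
    next
      case (link a b)
      \<comment> \<open>The walk through paths \<open>a\<close> and \<open>k\<close> leaves the sink
        of \<open>a\<close> towards \<open>k\<close>, not \<open>b\<close>, and so avoids the
        deleted link.\<close>
      obtain k where k: "k < 3" "k \<noteq> a" "k \<noteq> b" using third by blast
      have "path_end len a \<noteq> path_end len k"
        using link k path_end_mod[of a len] path_end_mod[of k len] by metis
      then have "(a, a) \<in> ?R\<^sup>+" using link k by (intro cycle[of a k]) auto
      then show ?thesis ..
    qed
  next
    case False
    then have "(0, 0) \<in> ?R\<^sup>+"
      using split_K3_path_arc split_K3_link_arc[of 0 1 len] split_K3_link_arc[of 1 0 len]
      by (intro cycle[of 0 1]) auto
    then show ?thesis ..
  qed
qed

lemma fasd_split_K3_le:
  "fasd (with_proj (split_K3 len)) \<le> enat ((len 0 + len 1 + len 2 + 6) div 2)"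
proof -
  let ?D = "with_proj (split_K3 len)"
  interpret pair_wf_digraph "split_K3 len" by (rule pair_wf_digraph_split_K3)
  interpret fin_digraph ?D
    by unfold_locales (auto simp: finite_pverts_split_K3 finite_parcs_split_K3)
  \<comment> \<open>An arc of a pair digraph is its own pair of ends, so the closure over
    \<open>parcs\<close> speaks about the digraph itself.\<close>
  have ends: "arcs_ends (?D\<lparr>arcs := parcs (split_K3 len) - F\<rparr>) = parcs (split_K3 len) - F" for F
    by (auto simp: arcs_ends_conv)
  have not_fas: "\<not> feedback_arc_set ?D F" if "F \<subseteq> {e}" for F e
  proof -
    obtain u where "(u, u) \<in> (parcs (split_K3 len) - {e})\<^sup>+"
      using split_K3_trancl_avoiding_arc by blast
    then have "(u, u) \<in> (parcs (split_K3 len) - F)\<^sup>+"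
      using that by (rule_tac trancl_mono) auto
    then show ?thesis
      by (intro trancl_imp_not_feedback_arc_set[of u F]) (simp only: ends)
  qed
  have "2 \<le> card F" if F: "feedback_arc_set ?D F" for F
  proof (rule ccontr)
    assume "\<not> 2 \<le> card F"
    moreover have "finite F"
      using F by (auto simp: feedback_arc_set_def intro: finite_subset finite_parcs_split_K3)
    ultimately have "\<exists>e. F \<subseteq> {e}"
      by (metis One_nat_def card_le_Suc0_iff_eq insertI1 less_2_cases_iff linorder_not_le
          order.refl subsetI zero_le singleton_iff)
    then show False using F not_fas by blast
  qed
  moreover have "\<not> acyclic_digraph ?D"
    \<comment> \<open>That the empty set is no feedback arc set means that the digraph has a
      cycle.\<close>
    using not_fas[of "{}"] by (simp add: feedback_arc_set_def with_proj_def)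
  ultimately have "fasd ?D \<le> enat (card (arcs ?D) div 2)"
    by (intro fasd_le_arcs_div) auto
  also have "\<dots> \<le> enat ((len 0 + len 1 + len 2 + 6) div 2)"
    using card_parcs_split_K3_le[of len] by (simp add: div_le_mono)
  finally show ?thesis .
qed

section \<open>Choice of the path lengths and the numerical bounds\<close>

lemma fasd_min_3_le:
  assumes "4 \<le> g"
  shows "fasd_min 3 g \<le> enat ((2 * g + 3 - g div 2) div 2)"
proof -
  \<comment> \<open>The girth requires any two lengths to sum to at least \<open>g - 2\<close>. One
    half is rounded down and two are rounded up, which saves an arc for odd \<open>g\<close>;
    \<open>4 \<le> g\<close> keeps all lengths positive.\<close>
  define len where "len i = (if i = 0 then g div 2 - 1 else g - g div 2 - 1)" for i :: nat
  let ?D = "split_K3 len"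
  have pos: "0 < len i" for i
    using assms by (auto simp: len_def)
  have "g \<le> len i + len j + 2" if "i \<noteq> j" for i j
    using that assms by (auto simp: len_def)
  then have girth: "enat g \<le> directed_girth (with_proj ?D)"
    by (intro directed_girth_split_K3)
  have "fasd_min 3 g \<le> fasd (with_proj ?D)"
    unfolding fasd_min_def
    using oriented_graph_split_K3[of len, OF pos] max_degree_split_K3[of len, OF pos] girth
    by (intro Inf_lower) blast
  also have "\<dots> \<le> enat ((len 0 + len 1 + len 2 + 6) div 2)"
    by (rule fasd_split_K3_le)
  also have "len 0 + len 1 + len 2 + 6 = 2 * g + 3 - g div 2"
    using assms by (simp add: len_def)
  finally show ?thesis .
qed

theorem theorem10:
  shows "(\<forall>g::nat. even g \<and> g \<ge> 4 \<longrightarrow>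
            fasd_min 3 g \<le> enat (nat (int g - \<lfloor>real g / 4 - 1\<rfloor>))) \<and>
         (\<forall>g::nat. odd g \<and> g \<ge> 7 \<longrightarrow>
            fasd_min 3 g \<le> enat (nat (int g - \<lfloor>(real g - 7) / 4\<rfloor>))) \<and>
         (\<forall>g::nat. g \<ge> 8 \<longrightarrow> fasd_min 3 g < enat g)"
proof (intro conjI allI impI)
  fix g :: nat
  assume g: "even g \<and> g \<ge> 4"
  have "\<lfloor>real g / 4 - 1\<rfloor> = int (g div 4) - 1"
    using floor_divide_of_nat_eq[of g 4, where 'a = real] by simp
  then have "nat (int g - \<lfloor>real g / 4 - 1\<rfloor>) = g + 1 - g div 4"
    by simp
  moreover have "(2 * g + 3 - g div 2) div 2 \<le> g + 1 - g div 4"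
  proof -
    obtain t where "g = 2 * t" using g by (auto elim: evenE)
    \<comment> \<open>Here \<open>g div 4\<close> is \<open>t div 2\<close>. The two sides are in
      fact equal, for either parity of \<open>t\<close>.\<close>
    moreover have "(3 * t + 3) div 2 \<le> 2 * t + 1 - t div 2" by linarith
    ultimately show ?thesis by (simp add: div_mult2_eq[of _ 2 2, simplified])
  qed
  ultimately have "(2 * g + 3 - g div 2) div 2 \<le> nat (int g - \<lfloor>real g / 4 - 1\<rfloor>)"
    by simp
  then show "fasd_min 3 g \<le> enat (nat (int g - \<lfloor>real g / 4 - 1\<rfloor>))"
    using g by (intro order_trans[OF fasd_min_3_le]) auto
next
  fix g :: nat
  assume g: "odd g \<and> g \<ge> 7"
  then have "\<lfloor>(real g - 7) / 4\<rfloor> = int ((g - 7) div 4)"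
    using floor_divide_of_nat_eq[of "g - 7" 4, where 'a = real] by (simp add: of_nat_diff)
  then have "nat (int g - \<lfloor>(real g - 7) / 4\<rfloor>) = g - (g - 7) div 4"
    by simp
  moreover have "(2 * g + 3 - g div 2) div 2 \<le> g - (g - 7) div 4"
  proof -
    obtain k where k: "g = 2 * k + 1" using g by (auto elim: oddE)
    \<comment> \<open>The shift gives \<open>g - 7 = 2 * t\<close>, so the subtracted term is
      \<open>t div 2\<close>.\<close>
    define t where "t = k - 3"
    have "g = 2 * t + 7" using g k by (simp add: t_def)
    moreover have "(3 * t + 14) div 2 \<le> 2 * t + 7 - t div 2" by linarith
    moreover have "(2 * t + 7) div 2 = t + 3" by simp
    ultimately show ?thesis by (simp add: div_mult2_eq[of _ 2 2, simplified])
  qed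
  ultimately have "(2 * g + 3 - g div 2) div 2 \<le> nat (int g - \<lfloor>(real g - 7) / 4\<rfloor>)"
    by simp
  then show "fasd_min 3 g \<le> enat (nat (int g - \<lfloor>(real g - 7) / 4\<rfloor>))"
    using g by (intro order_trans[OF fasd_min_3_le]) auto
next
  fix g :: nat
  assume g: "g \<ge> 8"
  \<comment> \<open>This amounts to \<open>g div 2 > 3\<close>. The sharper bound matters at
    \<open>g = 9\<close>, where the formula for odd \<open>g\<close> yields only 9.\<close>
  then have "(2 * g + 3 - g div 2) div 2 < g" by linarith
  then show "fasd_min 3 g < enat g"
    using g by (intro le_less_trans[OF fasd_min_3_le]) auto
qed

end
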